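(* Let $\mathbf{C}$ be a category, $\mathrm{I}$ a set, and $\mathbf{G}:\mathbf{Gl}(\mathrm{I})\to\mathbf{C}$ a $\mathbf{C}$-gluing data functor of type $\mathrm{I}$. Let $N$ be an object of $\mathbf{C}$ and let $\psi=(\psi_a:N\to\mathbf{G}(a))_{a\in\mathrm{Ob}(\mathbf{Gl}(\mathrm{I}))}$ be a family of morphisms of $\mathbf{C}$. The following statements are equivalent: (1) $(N,\psi)$ is a cone over the underlying diagram of $\mathbf{G}$; (2) for all $i,j,k\in\mathrm{I}$ and $n\in\{j,k\}$: (a) $\mathbf{G}(\tau_{[i,j]})\circ\psi_{[j,i]}=\psi_{[i,j]}$, (b) $\mathbf{G}(\eta_{i,[i,j]})\circ\psi_i=\psi_{[i,j]}$, (c) $\mathbf{G}(\eta_{[i,n],[i,j,k]})\circ\psi_{[i,n]}=\psi_{[i,j,k]}$; (3) for all $i,j,k\in\mathrm{I}$ and $n\in\{j,k\}$: (a) $\mathbf{G}(\tau_{[i,j]}\circ\eta_{j,[j,i]})\circ\psi_j=\psi_{[i,j]}$, (b) $\mathbf{G}(\eta_{i,[i,j]})\circ\psi_i=\psi_{[i,j]}$, (c) $\mathbf{G}(\eta_{[i,n],[i,j,k]})\circ\psi_{[i,n]}=\psi_{[i,j,k]}$.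
   Context: Gluing index category. For a set $\mathrm{I}$, the category $\mathbf{Gl}(\mathrm{I})$ has as objects the equivalence classes of elements of $\mathrm{I}\cup\mathrm{I}^2\cup\mathrm{I}^3$ under the equivalence relation generated by $i\sim(i,i)$, $(i,j,k)\sim(i,k,j)$ and $(i,j,j)\sim(i,j)$; the classes of $i$, $(i,j)$, $(i,j,k)$ are written $[i]$ (or simply $i$), $[i,j]$, $[i,j,k]$. There is at most one morphism between any two objects. The morphisms are the identities, the morphisms $\eta_{i,[i,j]}:i\to[i,j]$, $\tau_{[i,j]}:[j,i]\to[i,j]$, $\eta_{[i,n],[i,j,k]}:[i,n]\to[i,j,k]$ for $n\in\{j,k\}$, $\tau_{k,[i,j]}:[j,i,k]\to[i,j,k]$ (for all $i,j,k\in\mathrm{I}$), and their composites. In $\mathbf{Gl}(\mathrm{I})$, $[i,j,k]$ is the pushout of $[i,j]$ and $[i,k]$ over $i$ (along $\eta_{i,[i,j]}$ and $\eta_{i,[i,k]}$). Gluing data functor. A $\mathbf{C}$-gluing data functor of type $\mathrm{I}$ is a functor $\mathbf{G}:\mathbf{Gl}(\mathrm{I})\to\mathbf{C}$ sending, for all $i,j,k\in\mathrm{I}$, the pushout $[i,j,k]$ to the corresponding pushout in $\mathbf{C}$ (of $\mathbf{G}([i,j])$ and $\mathbf{G}([i,k])$ over $\mathbf{G}([i])$), the image of $\eta_{[i,n],[i,j,k]}$, $n\in\{j,k\}$, being the canonical morphism into that pushout. *)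

theory Defs
  imports Main
begin

section \<open>Categories, functors, pushouts and cones\<close>

record ('o, 'm) category =
  Ob :: "'o set"
  Mor :: "'m set"
  Dom :: "'m \<Rightarrow> 'o"
  Cod :: "'m \<Rightarrow> 'o"
  Ident :: "'o \<Rightarrow> 'm"
  Comp :: "'m \<Rightarrow> 'm \<Rightarrow> 'm"  (infixr \<open>\<cdot>\<index>\<close> 70)

text \<open>\<open>g \<cdot>\<^bsub>C\<^esub> f\<close> is ``\<open>g\<close> after \<open>f\<close>''; it is only meaningful when \<open>Cod C f = Dom C g\<close>.\<close>

definition Hom :: "('o, 'm) category \<Rightarrow> 'o \<Rightarrow> 'o \<Rightarrow> 'm set" where
  "Hom C a b = {f \<in> Mor C. Dom C f = a \<and> Cod C f = b}"

locale category =
  fixes C :: "('o, 'm) category" (structure)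
  assumes Dom_in_Ob: "f \<in> Mor C \<Longrightarrow> Dom C f \<in> Ob C"
    and Cod_in_Ob: "f \<in> Mor C \<Longrightarrow> Cod C f \<in> Ob C"
    and Ident_in_Hom: "a \<in> Ob C \<Longrightarrow> Ident C a \<in> Hom C a a"
    and Comp_in_Hom: "\<lbrakk>f \<in> Hom C a b; g \<in> Hom C b c\<rbrakk> \<Longrightarrow> g \<cdot> f \<in> Hom C a c"
    and Comp_Ident: "f \<in> Hom C a b \<Longrightarrow> f \<cdot> Ident C a = f"
    and Ident_Comp: "f \<in> Hom C a b \<Longrightarrow> Ident C b \<cdot> f = f"
    and Comp_assoc: "\<lbrakk>f \<in> Hom C a b; g \<in> Hom C b c; h \<in> Hom C c d\<rbrakk>
      \<Longrightarrow> h \<cdot> (g \<cdot> f) = (h \<cdot> g) \<cdot> f"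

record ('o1, 'm1, 'o2, 'm2) functor_data =
  on_Ob :: "'o1 \<Rightarrow> 'o2"
  on_Mor :: "'m1 \<Rightarrow> 'm2"

locale category_functor = J: category J + C: category C
  for J :: "('o1, 'm1) category" and C :: "('o2, 'm2) category" +
  fixes F :: "('o1, 'm1, 'o2, 'm2) functor_data"
  assumes on_Ob_in_Ob: "a \<in> Ob J \<Longrightarrow> on_Ob F a \<in> Ob C"
    and on_Mor_in_Hom: "f \<in> Hom J a b \<Longrightarrow> on_Mor F f \<in> Hom C (on_Ob F a) (on_Ob F b)"
    and on_Mor_Ident: "a \<in> Ob J \<Longrightarrow> on_Mor F (Ident J a) = Ident C (on_Ob F a)"
    and on_Mor_Comp: "\<lbrakk>f \<in> Hom J a b; g \<in> Hom J b c\<rbrakk>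
      \<Longrightarrow> on_Mor F (g \<cdot>\<^bsub>J\<^esub> f) = on_Mor F g \<cdot>\<^bsub>C\<^esub> on_Mor F f"

text \<open>The object \<open>Cod C p = Cod C q\<close>, with canonical morphisms \<open>p\<close> and \<open>q\<close>, is a pushout of
  \<open>Cod C f\<close> and \<open>Cod C g\<close> over \<open>Dom C f = Dom C g\<close> along \<open>f\<close> and \<open>g\<close>.\<close>

definition is_pushout :: "('o, 'm) category \<Rightarrow> 'm \<Rightarrow> 'm \<Rightarrow> 'm \<Rightarrow> 'm \<Rightarrow> bool" where
  "is_pushout C f g p q \<longleftrightarrow>
     {f, g, p, q} \<subseteq> Mor C \<and> Dom C f = Dom C g \<and>
     Dom C p = Cod C f \<and> Dom C q = Cod C g \<and> Cod C p = Cod C q \<and>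
     p \<cdot>\<^bsub>C\<^esub> f = q \<cdot>\<^bsub>C\<^esub> g \<and>
     (\<forall>x \<in> Ob C. \<forall>u \<in> Hom C (Cod C f) x. \<forall>v \<in> Hom C (Cod C g) x.
        u \<cdot>\<^bsub>C\<^esub> f = v \<cdot>\<^bsub>C\<^esub> g \<longrightarrow>
        (\<exists>!h. h \<in> Hom C (Cod C p) x \<and> h \<cdot>\<^bsub>C\<^esub> p = u \<and> h \<cdot>\<^bsub>C\<^esub> q = v))"

definition is_cone :: "('o1, 'm1) category \<Rightarrow> ('o2, 'm2) category \<Rightarrow>
    ('o1, 'm1, 'o2, 'm2) functor_data \<Rightarrow> 'o2 \<Rightarrow> ('o1 \<Rightarrow> 'm2) \<Rightarrow> bool" where
  "is_cone J C F N \<psi> \<longleftrightarrow>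
     N \<in> Ob C \<and> (\<forall>a \<in> Ob J. \<psi> a \<in> Hom C N (on_Ob F a)) \<and>
     (\<forall>f \<in> Mor J. on_Mor F f \<cdot>\<^bsub>C\<^esub> \<psi> (Dom J f) = \<psi> (Cod J f))"


section \<open>The gluing index category\<close>

text \<open>The tagged elements of \<open>I \<union> I\<^sup>2 \<union> I\<^sup>3\<close>.\<close>

datatype 'i gl_index = Ix1 'i | Ix2 'i 'i | Ix3 'i 'i 'i

definition gl_indices :: "'i set \<Rightarrow> 'i gl_index set" where
  "gl_indices I = {x. set_gl_index x \<subseteq> I}"

inductive gl_gen :: "'i gl_index \<Rightarrow> 'i gl_index \<Rightarrow> bool" where
  "gl_gen (Ix1 i) (Ix2 i i)"
| "gl_gen (Ix3 i j k) (Ix3 i k j)"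
| "gl_gen (Ix3 i j j) (Ix2 i j)"

text \<open>No generator changes the set of entries of an index, so restricting the equivalence closure to
  \<open>gl_indices I\<close> is the same as taking it within \<open>gl_indices I\<close>.\<close>

definition gl_rel :: "'i set \<Rightarrow> ('i gl_index \<times> 'i gl_index) set" where
  "gl_rel I = {(x, y). x \<in> gl_indices I \<and> y \<in> gl_indices I \<and> equivclp gl_gen x y}"

type_synonym 'i gl_ob = "'i gl_index set"

definition gl1 :: "'i set \<Rightarrow> 'i \<Rightarrow> 'i gl_ob" where
  "gl1 I i = gl_rel I `` {Ix1 i}"

definition gl2 :: "'i set \<Rightarrow> 'i \<Rightarrow> 'i \<Rightarrow> 'i gl_ob" where
  "gl2 I i j = gl_rel I `` {Ix2 i j}"

definition gl3 :: "'i set \<Rightarrow> 'i \<Rightarrow> 'i \<Rightarrow> 'i \<Rightarrow> 'i gl_ob" where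
  "gl3 I i j k = gl_rel I `` {Ix3 i j k}"

text \<open>As there is at most one morphism between any two objects, a morphism is encoded as the pair of
  its source and its target.\<close>

type_synonym 'i gl_mor = "'i gl_ob \<times> 'i gl_ob"

definition gl_eta1 :: "'i set \<Rightarrow> 'i \<Rightarrow> 'i \<Rightarrow> 'i gl_mor" where  \<comment> \<open>\<open>i \<rightarrow> [i,j]\<close>\<close>
  "gl_eta1 I i j = (gl1 I i, gl2 I i j)"

definition gl_tau2 :: "'i set \<Rightarrow> 'i \<Rightarrow> 'i \<Rightarrow> 'i gl_mor" where  \<comment> \<open>\<open>[j,i] \<rightarrow> [i,j]\<close>\<close>
  "gl_tau2 I i j = (gl2 I j i, gl2 I i j)"

definition gl_eta2 :: "'i set \<Rightarrow> 'i \<Rightarrow> 'i \<Rightarrow> 'i \<Rightarrow> 'i \<Rightarrow> 'i gl_mor" where  \<comment> \<open>\<open>[i,n] \<rightarrow> [i,j,k]\<close>\<close>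
  "gl_eta2 I n i j k = (gl2 I i n, gl3 I i j k)"

definition gl_tau3 :: "'i set \<Rightarrow> 'i \<Rightarrow> 'i \<Rightarrow> 'i \<Rightarrow> 'i gl_mor" where  \<comment> \<open>\<open>[j,i,k] \<rightarrow> [i,j,k]\<close>\<close>
  "gl_tau3 I k i j = (gl3 I j i k, gl3 I i j k)"

inductive_set gl_mors :: "'i set \<Rightarrow> 'i gl_mor set" for I :: "'i set" where
  ident: "a \<in> gl_indices I // gl_rel I \<Longrightarrow> (a, a) \<in> gl_mors I"
| eta1: "\<lbrakk>i \<in> I; j \<in> I\<rbrakk> \<Longrightarrow> gl_eta1 I i j \<in> gl_mors I"
| tau2: "\<lbrakk>i \<in> I; j \<in> I\<rbrakk> \<Longrightarrow> gl_tau2 I i j \<in> gl_mors I"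
| eta2: "\<lbrakk>i \<in> I; j \<in> I; k \<in> I; n \<in> {j, k}\<rbrakk> \<Longrightarrow> gl_eta2 I n i j k \<in> gl_mors I"
| tau3: "\<lbrakk>i \<in> I; j \<in> I; k \<in> I\<rbrakk> \<Longrightarrow> gl_tau3 I k i j \<in> gl_mors I"
| comp: "\<lbrakk>(a, b) \<in> gl_mors I; (b, c) \<in> gl_mors I\<rbrakk> \<Longrightarrow> (a, c) \<in> gl_mors I"

definition Gl :: "'i set \<Rightarrow> ('i gl_ob, 'i gl_mor) category" where
  "Gl I = \<lparr>Ob = gl_indices I // gl_rel I, Mor = gl_mors I, Dom = fst, Cod = snd,
     Ident = (\<lambda>a. (a, a)), Comp = (\<lambda>g f. (fst f, snd g))\<rparr>"

lemma gl_classes_in_quotient: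
  "i \<in> I \<Longrightarrow> gl1 I i \<in> gl_indices I // gl_rel I"
  "\<lbrakk>i \<in> I; j \<in> I\<rbrakk> \<Longrightarrow> gl2 I i j \<in> gl_indices I // gl_rel I"
  "\<lbrakk>i \<in> I; j \<in> I; k \<in> I\<rbrakk> \<Longrightarrow> gl3 I i j k \<in> gl_indices I // gl_rel I"
  by (auto simp: gl1_def gl2_def gl3_def gl_indices_def intro!: quotientI)

lemma gl_mors_in_quotient:
  "(a, b) \<in> gl_mors I \<Longrightarrow> a \<in> gl_indices I // gl_rel I \<and> b \<in> gl_indices I // gl_rel I"
  by (induction "(a, b)" arbitrary: a b rule: gl_mors.induct)
    (auto simp: gl_eta1_def gl_tau2_def gl_eta2_def gl_tau3_def intro: gl_classes_in_quotient)

lemma category_Gl: "category (Gl I)"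
  by standard (auto simp: Gl_def Hom_def dest: gl_mors_in_quotient intro: gl_mors.intros)


section \<open>Gluing data functors\<close>

locale gluing_data_functor = category_functor "Gl I" C G
  for I :: "'i set" and C :: "('o, 'm) category"
    and G :: "('i gl_ob, 'i gl_mor, 'o, 'm) functor_data" +
  assumes preserves_pushouts: "\<lbrakk>i \<in> I; j \<in> I; k \<in> I\<rbrakk> \<Longrightarrow>
    is_pushout C (on_Mor G (gl_eta1 I i j)) (on_Mor G (gl_eta1 I i k))
      (on_Mor G (gl_eta2 I j i j k)) (on_Mor G (gl_eta2 I k i j k))"

end

theory Submission
  imports Defs
begin

text \<open>
  The family \<open>\<psi>\<close> is a cone when every triangle with apex \<open>N\<close> over a morphism of \<open>Gl I\<close> commutes.
  By functoriality, if the triangle over \<open>f\<close> commutes, then the triangle over \<open>g \<circ> f\<close> commutes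
  exactly when the one over \<open>g\<close> does (lemma \<open>over_comp_iff\<close>). Composites therefore impose nothing
  new, and identities never do, so a cone need only be tested on the generators \<open>\<eta>\<close> and \<open>\<tau>\<close>.

  Condition (2) mentions every generator except \<open>\<tau>\<^bsub>k,[i,j]\<^esub> : [j,i,k] \<rightarrow> [i,j,k]\<close>. As \<open>Gl I\<close> has at
  most one morphism between two objects, the square
  \<open>\<tau>\<^bsub>k,[i,j]\<^esub> \<circ> \<eta>\<^bsub>[j,i],[j,i,k]\<^esub> = \<eta>\<^bsub>[i,j],[i,j,k]\<^esub> \<circ> \<tau>\<^bsub>[i,j]\<^esub>\<close> commutes. The triangles over both factors
  on the right and over the first factor on the left commute by (2), hence so does the one over
  \<open>\<tau>\<^bsub>k,[i,j]\<^esub>\<close> (lemma \<open>over_gl_tau3\<close>). Conditions (2) and (3) differ only in (a), and given (b) for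
  \<open>\<eta>\<^bsub>j,[j,i]\<^esub>\<close> the two versions of (a) are again related by \<open>over_comp_iff\<close>.
\<close>

context category_functor
begin

definition triangle_commutes :: "('o1 \<Rightarrow> 'm2) \<Rightarrow> 'm1 \<Rightarrow> bool" where
  "triangle_commutes \<psi> f \<longleftrightarrow> on_Mor F f \<cdot>\<^bsub>C\<^esub> \<psi> (Dom J f) = \<psi> (Cod J f)"

text \<open>Functoriality and associativity identify \<open>F (g \<circ> f) \<circ> \<psi> a\<close> with \<open>F g \<circ> (F f \<circ> \<psi> a)\<close>, and the
  triangle over \<open>f\<close> turns the latter into \<open>F g \<circ> \<psi> b\<close>. The equivalence, rather than the closure of
  commuting triangles under composition, is what allows a first factor to be cancelled.\<close>

lemma over_comp_iff:
  assumes f: "f \<in> Hom J a b" and g: "g \<in> Hom J b c"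
    and leg: "\<psi> a \<in> Hom C N (on_Ob F a)"
    and tri: "triangle_commutes \<psi> f"
  shows "triangle_commutes \<psi> (g \<cdot>\<^bsub>J\<^esub> f) \<longleftrightarrow> triangle_commutes \<psi> g"
proof -
  have gf: "g \<cdot>\<^bsub>J\<^esub> f \<in> Hom J a c"
    using J.Comp_in_Hom[OF f g] .
  have "on_Mor F (g \<cdot>\<^bsub>J\<^esub> f) \<cdot>\<^bsub>C\<^esub> \<psi> a = on_Mor F g \<cdot>\<^bsub>C\<^esub> (on_Mor F f \<cdot>\<^bsub>C\<^esub> \<psi> a)"
    using C.Comp_assoc[OF leg on_Mor_in_Hom[OF f] on_Mor_in_Hom[OF g]] on_Mor_Comp[OF f g] by simp
  also have "\<dots> = on_Mor F g \<cdot>\<^bsub>C\<^esub> \<psi> b"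
    using tri f by (simp add: triangle_commutes_def Hom_def)
  finally show ?thesis
    using f g gf by (simp add: triangle_commutes_def Hom_def)
qed

lemma over_Ident:
  assumes "a \<in> Ob J" and "\<psi> a \<in> Hom C N (on_Ob F a)"
  shows "triangle_commutes \<psi> (Ident J a)"
  using J.Ident_in_Hom[OF assms(1)] C.Ident_Comp[OF assms(2)] on_Mor_Ident[OF assms(1)]
  by (simp add: triangle_commutes_def Hom_def)

end

lemma Gl_simps [simp]:
  "Ob (Gl I) = gl_indices I // gl_rel I" "Mor (Gl I) = gl_mors I"
  "Dom (Gl I) = fst" "Cod (Gl I) = snd"
  "Ident (Gl I) a = (a, a)" "g \<cdot>\<^bsub>Gl I\<^esub> f = (fst f, snd g)"
  by (simp_all add: Gl_def)

lemma Hom_Gl_iff: "f \<in> Hom (Gl I) a b \<longleftrightarrow> f = (a, b) \<and> (a, b) \<in> gl_mors I"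
  by (auto simp: Hom_def)

context gluing_data_functor
begin

lemma triangle_commutes_Gl_iff:
  "triangle_commutes \<psi> (a, b) \<longleftrightarrow> on_Mor G (a, b) \<cdot>\<^bsub>C\<^esub> \<psi> a = \<psi> b"
  by (simp add: triangle_commutes_def)

lemma over_Gl_comp_iff:
  assumes "\<And>a. a \<in> Ob (Gl I) \<Longrightarrow> \<psi> a \<in> Hom C N (on_Ob G a)"
    and "(a, b) \<in> gl_mors I" and "(b, c) \<in> gl_mors I" and "triangle_commutes \<psi> (a, b)"
  shows "triangle_commutes \<psi> (a, c) \<longleftrightarrow> triangle_commutes \<psi> (b, c)"
proof -
  have "\<psi> a \<in> Hom C N (on_Ob G a)"
    using gl_mors_in_quotient[OF assms(2)] by (intro assms(1)) simp
  then have "triangle_commutes \<psi> ((b, c) \<cdot>\<^bsub>Gl I\<^esub> (a, b)) \<longleftrightarrow> triangle_commutes \<psi> (b, c)"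
    using assms(2-4) by (intro over_comp_iff) (auto simp: Hom_Gl_iff)
  then show ?thesis
    by simp
qed

text \<open>The composite \<open>[j,i] \<rightarrow> [i,j,k]\<close> factors through \<open>[i,j]\<close> and through \<open>[j,i,k]\<close>. The first
  factorization shows that its triangle commutes, and the second then cancels \<open>\<eta>\<^bsub>[j,i],[j,i,k]\<^esub>\<close>.\<close>

lemma over_gl_tau3:
  assumes legs: "\<And>a. a \<in> Ob (Gl I) \<Longrightarrow> \<psi> a \<in> Hom C N (on_Ob G a)"
    and ijk: "i \<in> I" "j \<in> I" "k \<in> I"
    and "triangle_commutes \<psi> (gl_tau2 I i j)"
    and "triangle_commutes \<psi> (gl_eta2 I j i j k)"
    and "triangle_commutes \<psi> (gl_eta2 I i j i k)"
  shows "triangle_commutes \<psi> (gl_tau3 I k i j)"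
proof -
  have mors: "(gl2 I j i, gl2 I i j) \<in> gl_mors I" "(gl2 I i j, gl3 I i j k) \<in> gl_mors I"
      "(gl2 I j i, gl3 I j i k) \<in> gl_mors I" "(gl3 I j i k, gl3 I i j k) \<in> gl_mors I"
    using gl_mors.tau2[of i I j] gl_mors.eta2[of i I j k j] gl_mors.eta2[of j I i k i]
      gl_mors.tau3[of i I j k] ijk
    by (simp_all add: gl_tau2_def gl_eta2_def gl_tau3_def)
  have "triangle_commutes \<psi> (gl2 I j i, gl3 I i j k)"
    using over_Gl_comp_iff[of \<psi>, OF legs mors(1,2)] assms(5,6)
    by (simp add: gl_tau2_def gl_eta2_def)
  then show ?thesis
    using over_Gl_comp_iff[of \<psi>, OF legs mors(3,4)] assms(7)
    by (simp add: gl_tau3_def gl_eta2_def)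
qed

lemma all_triangles_commuteI:
  assumes legs: "\<And>a. a \<in> Ob (Gl I) \<Longrightarrow> \<psi> a \<in> Hom C N (on_Ob G a)"
    and tau2: "\<And>i j. \<lbrakk>i \<in> I; j \<in> I\<rbrakk> \<Longrightarrow> triangle_commutes \<psi> (gl_tau2 I i j)"
    and eta1: "\<And>i j. \<lbrakk>i \<in> I; j \<in> I\<rbrakk> \<Longrightarrow> triangle_commutes \<psi> (gl_eta1 I i j)"
    and eta2: "\<And>i j k n. \<lbrakk>i \<in> I; j \<in> I; k \<in> I; n \<in> {j, k}\<rbrakk>
      \<Longrightarrow> triangle_commutes \<psi> (gl_eta2 I n i j k)"
    and "f \<in> gl_mors I"
  shows "triangle_commutes \<psi> f"
  using \<open>f \<in> gl_mors I\<close>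
proof (induction rule: gl_mors.induct)
  case (ident a)
  then show ?case
    using over_Ident[of a \<psi> N] legs[of a] by simp
next
  case (tau3 i j k)
  then show ?case
    by (intro over_gl_tau3[OF legs] tau2 eta2) auto
next
  case (comp a b c)
  then show ?case
    using over_Gl_comp_iff[of \<psi>, OF legs] by blast
qed (auto intro: tau2 eta1 eta2)

lemma over_tau2_eta1_iff:
  assumes legs: "\<And>a. a \<in> Ob (Gl I) \<Longrightarrow> \<psi> a \<in> Hom C N (on_Ob G a)"
    and "i \<in> I" "j \<in> I" and "triangle_commutes \<psi> (gl_eta1 I j i)"
  shows "triangle_commutes \<psi> (gl_tau2 I i j \<cdot>\<^bsub>Gl I\<^esub> gl_eta1 I j i) \<longleftrightarrow>
    triangle_commutes \<psi> (gl_tau2 I i j)"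
  using over_Gl_comp_iff[of \<psi> N "gl1 I j" "gl2 I j i" "gl2 I i j", OF legs] assms(2-4)
    gl_mors.eta1[of j I i] gl_mors.tau2[of i I j]
  by (simp add: gl_eta1_def gl_tau2_def)

end

theorem lemma1p6:
  fixes C :: "('o, 'm) category" and I :: "'i set"
    and G :: "('i gl_ob, 'i gl_mor, 'o, 'm) functor_data"
    and N :: 'o and \<psi> :: "'i gl_ob \<Rightarrow> 'm"
  assumes "category C"
    and "gluing_data_functor I C G"
    and "N \<in> Ob C"
    and "\<And>a. a \<in> Ob (Gl I) \<Longrightarrow> \<psi> a \<in> Hom C N (on_Ob G a)"
  shows
    "(is_cone (Gl I) C G N \<psi> \<longleftrightarrow>
        (\<forall>i\<in>I. \<forall>j\<in>I. \<forall>k\<in>I. \<forall>n\<in>{j, k}.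
           on_Mor G (gl_tau2 I i j) \<cdot>\<^bsub>C\<^esub> \<psi> (gl2 I j i) = \<psi> (gl2 I i j) \<and>
           on_Mor G (gl_eta1 I i j) \<cdot>\<^bsub>C\<^esub> \<psi> (gl1 I i) = \<psi> (gl2 I i j) \<and>
           on_Mor G (gl_eta2 I n i j k) \<cdot>\<^bsub>C\<^esub> \<psi> (gl2 I i n) = \<psi> (gl3 I i j k))) \<and>
     (is_cone (Gl I) C G N \<psi> \<longleftrightarrow>
        (\<forall>i\<in>I. \<forall>j\<in>I. \<forall>k\<in>I. \<forall>n\<in>{j, k}.
           on_Mor G (gl_tau2 I i j \<cdot>\<^bsub>Gl I\<^esub> gl_eta1 I j i) \<cdot>\<^bsub>C\<^esub> \<psi> (gl1 I j) = \<psi> (gl2 I i j) \<and>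
           on_Mor G (gl_eta1 I i j) \<cdot>\<^bsub>C\<^esub> \<psi> (gl1 I i) = \<psi> (gl2 I i j) \<and>
           on_Mor G (gl_eta2 I n i j k) \<cdot>\<^bsub>C\<^esub> \<psi> (gl2 I i n) = \<psi> (gl3 I i j k)))"
proof -
  interpret gluing_data_functor I C G
    by fact
  note legs = assms(4)
  let ?tri = "triangle_commutes \<psi>"
  define conds where "conds \<longleftrightarrow> (\<forall>i\<in>I. \<forall>j\<in>I. \<forall>k\<in>I. \<forall>n\<in>{j, k}.
    ?tri (gl_tau2 I i j) \<and> ?tri (gl_eta1 I i j) \<and> ?tri (gl_eta2 I n i j k))"
  define conds' where "conds' \<longleftrightarrow> (\<forall>i\<in>I. \<forall>j\<in>I. \<forall>k\<in>I. \<forall>n\<in>{j, k}.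
    ?tri (gl_tau2 I i j \<cdot>\<^bsub>Gl I\<^esub> gl_eta1 I j i) \<and> ?tri (gl_eta1 I i j) \<and> ?tri (gl_eta2 I n i j k))"
  have cone_iff: "is_cone (Gl I) C G N \<psi> \<longleftrightarrow> (\<forall>f\<in>gl_mors I. ?tri f)"
    using assms(3) legs by (auto simp: is_cone_def triangle_commutes_def)
  have "(\<forall>f\<in>gl_mors I. ?tri f) \<longleftrightarrow> conds"
  proof
    assume "\<forall>f\<in>gl_mors I. ?tri f"
    then show conds
      unfolding conds_def by (blast intro: gl_mors.intros)
  next
    assume conds
    then have "?tri f" if "f \<in> gl_mors I" for f
      unfolding conds_def by (intro all_triangles_commuteI[OF legs _ _ _ that]) blast+
    then show "\<forall>f\<in>gl_mors I. ?tri f"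
      by blast
  qed
  moreover have "conds \<longleftrightarrow> conds'"
  proof -
    have "?tri (gl_tau2 I i j \<cdot>\<^bsub>Gl I\<^esub> gl_eta1 I j i) \<longleftrightarrow> ?tri (gl_tau2 I i j)"
      if "i \<in> I" "j \<in> I" "?tri (gl_eta1 I j i)" for i j
      using over_tau2_eta1_iff[OF legs that] .
    then show ?thesis
      unfolding conds_def conds'_def by blast
  qed
  ultimately have "(is_cone (Gl I) C G N \<psi> \<longleftrightarrow> conds) \<and> (is_cone (Gl I) C G N \<psi> \<longleftrightarrow> conds')"
    using cone_iff by blast
  then show ?thesis
    unfolding conds_def conds'_def triangle_commutes_def gl_tau2_def gl_eta1_def gl_eta2_def
      Gl_simps fst_conv snd_conv .
qed

end
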